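(* Let $Q\ge 2$ be an integer, let $S$ be a set of vertices of the homogeneous Cayley tree $\mathbb G^Q$, and let $Y$ be the graph obtained from $\mathbb G^Q$ by adding one self-loop at each vertex of $S$. Then, in the range $\lambda>\|A_{\mathbb G^Q}\|$, the equation $$\big\|P_{\ell^2(S)}R_{A_{\mathbb G^Q}}(\lambda)P_{\ell^2(S)}\big\|=1 \qquad ( * )$$ has at most one solution. If a solution exists, the unique solution of $( * )$ is the norm $\|A_Y\|$ of $A_Y$. Conversely, if $\lambda_*:=\|A_Y\|>\|A_{\mathbb G^Q}\|$, then $\lambda_*$ satisfies $( * )$.
   Context: For a graph $X$ (undirected, self-loops allowed) the adjacency operator $A_X$ acts on $\ell^2(VX)$ and its matrix entry $A_{xy}$ is the number of edges joining $x$ and $y$; a single self-loop at $x$ contributes $A_{xx}=1$. $\mathbb G^Q$ denotes the homogeneous Cayley tree of order $Q$, i.e. the infinite tree in which every vertex has degree $Q$. $P_{\ell^2(S)}$ is the orthogonal projection of $\ell^2(\mathbb G^Q)$ onto $\ell^2(S)$. For an operator $B$, $R_B(\lambda)=(\lambda\mathbf 1-B)^{-1}$ is the resolvent. *)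

theory Defs
  imports "HOL-Analysis.Analysis"
begin

section \<open>The Hilbert space of square-summable complex functions\<close>

typedef 'v ell2 = "{f :: 'v \<Rightarrow> complex. (\<lambda>x. (cmod (f x))\<^sup>2) summable_on UNIV}"
  morphisms ell2_apply Abs_ell2
  by (rule exI[of _ "\<lambda>_. 0"]) simp

setup_lifting type_definition_ell2

lemma ell2_summable: "(\<lambda>x. (cmod (ell2_apply f x))\<^sup>2) summable_on UNIV"
  using ell2_apply[of f] by simp

lemma ell2_eqI: "(\<And>x. ell2_apply f x = ell2_apply g x) \<Longrightarrow> f = g"
  by (metis ell2_apply_inject ext)

lemma square_summable_add:
  assumes "(\<lambda>x. (cmod (f x))\<^sup>2) summable_on A" "(\<lambda>x. (cmod (g x))\<^sup>2) summable_on A"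
  shows "(\<lambda>x. (cmod (f x + g x))\<^sup>2) summable_on A"
proof (rule summable_on_comparison_test)
  show "(\<lambda>x. 2 * (cmod (f x))\<^sup>2 + 2 * (cmod (g x))\<^sup>2) summable_on A"
    by (intro summable_on_add summable_on_cmult_right assms)
  fix x assume "x \<in> A"
  have "(cmod (f x + g x))\<^sup>2 \<le> (cmod (f x) + cmod (g x))\<^sup>2"
    by (intro power_mono norm_triangle_ineq) auto
  also have "\<dots> \<le> 2 * (cmod (f x))\<^sup>2 + 2 * (cmod (g x))\<^sup>2"
    using sum_squares_bound[of "cmod (f x)" "cmod (g x)"] by (simp add: power2_sum)
  finally show "(cmod (f x + g x))\<^sup>2 \<le> 2 * (cmod (f x))\<^sup>2 + 2 * (cmod (g x))\<^sup>2" .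
qed auto

lemma square_summable_inner:
  assumes "(\<lambda>x. (cmod (f x))\<^sup>2) summable_on A" "(\<lambda>x. (cmod (g x))\<^sup>2) summable_on A"
  shows "(\<lambda>x. f x \<bullet> g x) summable_on A"
proof -
  have "(\<lambda>x. norm (f x \<bullet> g x)) summable_on A"
  proof (rule summable_on_comparison_test)
    show "(\<lambda>x. (cmod (f x))\<^sup>2 + (cmod (g x))\<^sup>2) summable_on A"
      by (intro summable_on_add assms)
    fix x assume "x \<in> A"
    have "\<bar>f x \<bullet> g x\<bar> \<le> cmod (f x) * cmod (g x)" by (rule Cauchy_Schwarz_ineq2)
    also have "\<dots> \<le> (cmod (f x))\<^sup>2 + (cmod (g x))\<^sup>2"
    proof -
      have "0 \<le> cmod (f x) * cmod (g x)" by simp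
      with sum_squares_bound[of "cmod (f x)" "cmod (g x)"] show ?thesis by linarith
    qed
    finally show "norm (f x \<bullet> g x) \<le> (cmod (f x))\<^sup>2 + (cmod (g x))\<^sup>2" by simp
  qed auto
  thus ?thesis by (rule abs_summable_summable)
qed

text \<open>Complex \<open>\<ell>\<^sup>2\<close> is equipped with the real part of its usual inner product; \<open>\<bullet>\<close> on \<^typ>\<open>complex\<close> is
  \<open>z \<bullet> w = Re (z * cnj w)\<close>. The norm, and hence the operator norm, is the usual one, and a
  complex subspace has the same orthogonal complement for both inner products. Elements of
  \<^typ>\<open>'v ell2 \<Rightarrow>\<^sub>L 'v ell2\<close> are real-linear, but a two-sided inverse of a complex-linear operator is
  again complex-linear, so that resolvents at real points are the usual ones as well.\<close>

instantiation ell2 :: (type) real_inner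
begin

lift_definition zero_ell2 :: "'a ell2" is "\<lambda>_. 0" by simp

lift_definition plus_ell2 :: "'a ell2 \<Rightarrow> 'a ell2 \<Rightarrow> 'a ell2" is "\<lambda>f g x. f x + g x"
  by (simp add: square_summable_add)

lift_definition uminus_ell2 :: "'a ell2 \<Rightarrow> 'a ell2" is "\<lambda>f x. - f x" by simp

lift_definition minus_ell2 :: "'a ell2 \<Rightarrow> 'a ell2 \<Rightarrow> 'a ell2" is "\<lambda>f g x. f x - g x"
  subgoal for f g using square_summable_add[of f UNIV "\<lambda>x. - g x"] by simp
  done

lift_definition scaleR_ell2 :: "real \<Rightarrow> 'a ell2 \<Rightarrow> 'a ell2" is "\<lambda>r f x. r *\<^sub>R f x"
  by (simp add: power_mult_distrib summable_on_cmult_right)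

definition inner_ell2 :: "'a ell2 \<Rightarrow> 'a ell2 \<Rightarrow> real"
  where "inner_ell2 f g = (\<Sum>\<^sub>\<infinity>x. ell2_apply f x \<bullet> ell2_apply g x)"

definition norm_ell2 :: "'a ell2 \<Rightarrow> real"
  where "norm_ell2 f = sqrt (\<Sum>\<^sub>\<infinity>x. (cmod (ell2_apply f x))\<^sup>2)"

definition dist_ell2 :: "'a ell2 \<Rightarrow> 'a ell2 \<Rightarrow> real"
  where "dist_ell2 f g = norm (f - g)"

definition sgn_ell2 :: "'a ell2 \<Rightarrow> 'a ell2"
  where "sgn_ell2 f = scaleR (inverse (norm f)) f"

definition uniformity_ell2 :: "('a ell2 \<times> 'a ell2) filter"
  where "uniformity_ell2 = (INF e\<in>{0<..}. principal {(f, g). dist f g < e})"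

definition open_ell2 :: "'a ell2 set \<Rightarrow> bool"
  where "open_ell2 U = (\<forall>f\<in>U. \<forall>\<^sub>F (f', g) in uniformity. f' = f \<longrightarrow> g \<in> U)"

instance
proof
  fix f g h :: "'a ell2" and r s :: real
  note s = square_summable_inner[OF ell2_summable ell2_summable]
  show "f + g + h = f + (g + h)" by transfer (simp add: add.assoc)
  show "f + g = g + f" by transfer (simp add: add.commute)
  show "0 + f = f" by transfer simp
  show "- f + f = 0" by transfer simp
  show "f - g = f + - g" by transfer simp
  show "r *\<^sub>R (f + g) = r *\<^sub>R f + r *\<^sub>R g" by transfer (simp add: scaleR_add_right)
  show "(r + s) *\<^sub>R f = r *\<^sub>R f + s *\<^sub>R f" by transfer (simp add: scaleR_add_left)
  show "r *\<^sub>R s *\<^sub>R f = (r * s) *\<^sub>R f" by transfer simp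
  show "1 *\<^sub>R f = f" by transfer simp
  show "dist f g = norm (f - g)" by (rule dist_ell2_def)
  show "sgn f = inverse (norm f) *\<^sub>R f" by (rule sgn_ell2_def)
  show "uniformity = (INF e\<in>{0<..}. principal {(f :: 'a ell2, g). dist f g < e})"
    by (rule uniformity_ell2_def)
  show "open U = (\<forall>f\<in>U. \<forall>\<^sub>F (f', g) in uniformity. f' = f \<longrightarrow> g \<in> U)" for U :: "'a ell2 set"
    by (rule open_ell2_def)
  show "f \<bullet> g = g \<bullet> f" by (simp add: inner_ell2_def inner_commute)
  show "(f + g) \<bullet> h = f \<bullet> h + g \<bullet> h"
    by (simp add: inner_ell2_def plus_ell2.rep_eq inner_add_left infsum_add s)
  show "r *\<^sub>R f \<bullet> g = r * (f \<bullet> g)"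
    by (simp add: inner_ell2_def scaleR_ell2.rep_eq infsum_cmult_right s)
  show "0 \<le> f \<bullet> f" by (simp add: inner_ell2_def infsum_nonneg)
  show "f \<bullet> f = 0 \<longleftrightarrow> f = 0"
  proof
    assume "f \<bullet> f = 0"
    hence "ell2_apply f x \<bullet> ell2_apply f x = 0" for x
      unfolding inner_ell2_def using s by (intro nonneg_infsum_le_0D[of _ UNIV]) auto
    thus "f = 0" by (intro ell2_eqI) (simp add: zero_ell2.rep_eq)
  qed (simp add: inner_ell2_def zero_ell2.rep_eq)
  show "norm f = sqrt (f \<bullet> f)"
    by (simp add: inner_ell2_def norm_ell2_def power2_norm_eq_inner)
qed

end

lemma norm_ell2_sum_le:
  assumes "finite F"
  shows "(\<Sum>x\<in>F. (cmod (ell2_apply f x))\<^sup>2) \<le> (norm f)\<^sup>2"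
proof -
  have "(\<Sum>x\<in>F. (cmod (ell2_apply f x))\<^sup>2) \<le> (\<Sum>\<^sub>\<infinity>x. (cmod (ell2_apply f x))\<^sup>2)"
    by (rule finite_sum_le_infsum) (use assms ell2_summable in auto)
  thus ?thesis by (simp add: norm_ell2_def infsum_nonneg)
qed

lemma ell2_boundedI:
  assumes "\<And>F. finite F \<Longrightarrow> (\<Sum>x\<in>F. (cmod (f x))\<^sup>2) \<le> c\<^sup>2" "0 \<le> c"
  shows "(\<lambda>x. (cmod (f x))\<^sup>2) summable_on UNIV"
    and "ell2_apply (Abs_ell2 f) = f"
    and "norm (Abs_ell2 f) \<le> c"
proof -
  show s: "(\<lambda>x. (cmod (f x))\<^sup>2) summable_on UNIV"
    by (rule nonneg_bdd_above_summable_on) (auto intro!: bdd_aboveI2 assms(1))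
  thus a: "ell2_apply (Abs_ell2 f) = f" by (simp add: Abs_ell2_inverse)
  have "(\<Sum>\<^sub>\<infinity>x. (cmod (f x))\<^sup>2) \<le> c\<^sup>2"
    by (rule infsum_le_finite_sums[OF s]) (use assms in auto)
  thus "norm (Abs_ell2 f) \<le> c"
    unfolding norm_ell2_def a by (intro real_le_lsqrt) (use assms in auto)
qed

instance ell2 :: (type) banach
proof
  fix X :: "nat \<Rightarrow> 'a ell2"
  assume "Cauchy X"
  have pt: "cmod (ell2_apply f x) \<le> norm f" for f :: "'a ell2" and x
    using norm_ell2_sum_le[of "{x}" f] by (simp add: power2_le_iff_abs_le)
  have "\<exists>g. (\<lambda>n. ell2_apply (X n) x) \<longlonglongrightarrow> g" for x
  proof -
    have "Cauchy (\<lambda>n. ell2_apply (X n) x)"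
    proof (rule metric_CauchyI)
      fix e :: real assume "0 < e"
      then obtain M where M: "\<And>m n. m \<ge> M \<Longrightarrow> n \<ge> M \<Longrightarrow> norm (X m - X n) < e"
        using \<open>Cauchy X\<close> unfolding Cauchy_def dist_norm by meson
      have "dist (ell2_apply (X m) x) (ell2_apply (X n) x) < e" if "m \<ge> M" "n \<ge> M" for m n
        using M[OF that] pt[of "X m - X n" x] by (simp add: dist_norm minus_ell2.rep_eq)
      thus "\<exists>M. \<forall>m\<ge>M. \<forall>n\<ge>M. dist (ell2_apply (X m) x) (ell2_apply (X n) x) < e" by blast
    qed
    thus ?thesis by (simp add: Cauchy_convergent_iff convergent_def)
  qed
  then obtain g where g: "\<And>x. (\<lambda>n. ell2_apply (X n) x) \<longlonglongrightarrow> g x" by metis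
  have tail: "(\<Sum>x\<in>F. (cmod (ell2_apply (X m) x - g x))\<^sup>2) \<le> e\<^sup>2"
    if "finite F" "0 < e" "\<And>n. n \<ge> M \<Longrightarrow> norm (X m - X n) < e" for F e m M
  proof (rule LIMSEQ_le_const2)
    show "(\<lambda>n. \<Sum>x\<in>F. (cmod (ell2_apply (X m) x - ell2_apply (X n) x))\<^sup>2)
        \<longlonglongrightarrow> (\<Sum>x\<in>F. (cmod (ell2_apply (X m) x - g x))\<^sup>2)"
      by (intro tendsto_intros g)
    have "(\<Sum>x\<in>F. (cmod (ell2_apply (X m) x - ell2_apply (X n) x))\<^sup>2) \<le> e\<^sup>2" if "n \<ge> M" for n
    proof -
      have "(\<Sum>x\<in>F. (cmod (ell2_apply (X m) x - ell2_apply (X n) x))\<^sup>2) \<le> (norm (X m - X n))\<^sup>2"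
        using norm_ell2_sum_le[OF \<open>finite F\<close>, of "X m - X n"] by (simp add: minus_ell2.rep_eq)
      also have "\<dots> \<le> e\<^sup>2"
        using \<open>\<And>n. n \<ge> M \<Longrightarrow> norm (X m - X n) < e\<close>[OF that] by (intro power_mono) auto
      finally show ?thesis .
    qed
    thus "\<exists>N. \<forall>n\<ge>N. (\<Sum>x\<in>F. (cmod (ell2_apply (X m) x - ell2_apply (X n) x))\<^sup>2) \<le> e\<^sup>2" by blast
  qed
  have close: "\<exists>M. \<forall>m\<ge>M. (\<lambda>x. (cmod (ell2_apply (X m) x - g x))\<^sup>2) summable_on UNIV \<and>
      norm (Abs_ell2 (\<lambda>x. ell2_apply (X m) x - g x)) \<le> e" if "0 < e" for e
  proof -
    from that obtain M where M: "\<And>m n. m \<ge> M \<Longrightarrow> n \<ge> M \<Longrightarrow> norm (X m - X n) < e"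
      using \<open>Cauchy X\<close> unfolding Cauchy_def dist_norm by meson
    have "(\<Sum>x\<in>F. (cmod (ell2_apply (X m) x - g x))\<^sup>2) \<le> e\<^sup>2" if "m \<ge> M" "finite F" for m F
      by (rule tail[OF \<open>finite F\<close> \<open>0 < e\<close> M]) (use \<open>m \<ge> M\<close> in auto)
    thus ?thesis
      using that by (intro exI[of _ M] allI impI conjI ell2_boundedI(1) ell2_boundedI(3)[where c = e]) auto
  qed
  obtain m where "(\<lambda>x. (cmod (ell2_apply (X m) x - g x))\<^sup>2) summable_on UNIV"
    using close[of 1] by auto
  hence "(\<lambda>x. (cmod (- (ell2_apply (X m) x - g x) + ell2_apply (X m) x))\<^sup>2) summable_on UNIV"
    by (intro square_summable_add ell2_summable) (simp add: norm_minus_commute)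
  hence "ell2_apply (Abs_ell2 g) = g" by (simp add: Abs_ell2_inverse)
  hence diff: "Abs_ell2 (\<lambda>x. ell2_apply (X m) x - g x) = X m - Abs_ell2 g" for m
    using ell2_apply_inverse[of "X m - Abs_ell2 g"] by (simp add: minus_ell2.rep_eq)
  have "X \<longlonglongrightarrow> Abs_ell2 g"
  proof (rule metric_LIMSEQ_I)
    fix e :: real assume "0 < e"
    then obtain M where M: "\<And>m. m \<ge> M \<Longrightarrow> norm (X m - Abs_ell2 g) \<le> e / 2"
      using close[of "e / 2"] by (auto simp: diff)
    have "dist (X m) (Abs_ell2 g) < e" if "m \<ge> M" for m
      using M[OF that] \<open>0 < e\<close> by (simp add: dist_norm)
    thus "\<exists>M. \<forall>m\<ge>M. dist (X m) (Abs_ell2 g) < e" by blast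
  qed
  thus "convergent X" by (rule convergentI)
qed

section \<open>Orthogonal projections and resolvents\<close>

definition orthogonal_projection :: "'a::real_inner set \<Rightarrow> 'a \<Rightarrow>\<^sub>L 'a"
  where "orthogonal_projection M =
    Blinfun (\<lambda>f. THE g. g \<in> M \<and> (\<forall>h\<in>M. orthogonal (f - g) h))"

definition resolvent :: "('a::real_normed_vector \<Rightarrow>\<^sub>L 'a) \<Rightarrow> real \<Rightarrow> ('a \<Rightarrow>\<^sub>L 'a)"
  where "resolvent B \<mu> =
    (THE R. R o\<^sub>L (\<mu> *\<^sub>R id_blinfun - B) = id_blinfun \<and> (\<mu> *\<^sub>R id_blinfun - B) o\<^sub>L R = id_blinfun)"

lemma resolvent_eqI:
  assumes "R o\<^sub>L (\<mu> *\<^sub>R id_blinfun - B) = id_blinfun" "(\<mu> *\<^sub>R id_blinfun - B) o\<^sub>L R = id_blinfun"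
  shows "resolvent B \<mu> = R"
  unfolding resolvent_def
proof (rule the_equality)
  fix R' assume R': "R' o\<^sub>L (\<mu> *\<^sub>R id_blinfun - B) = id_blinfun \<and> (\<mu> *\<^sub>R id_blinfun - B) o\<^sub>L R' = id_blinfun"
  show "R' = R"
  proof (rule blinfun_eqI)
    fix x
    let ?y = "blinfun_apply R x"
    have "blinfun_apply R' (blinfun_apply (\<mu> *\<^sub>R id_blinfun - B) ?y) = ?y"
      using R' by (metis blinfun_apply_blinfun_compose blinfun_apply_id_blinfun)
    moreover have "blinfun_apply (\<mu> *\<^sub>R id_blinfun - B) ?y = x"
      using assms(2) by (metis blinfun_apply_blinfun_compose blinfun_apply_id_blinfun)
    ultimately show "blinfun_apply R' x = ?y" by simp
  qed
qed (use assms in auto)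

lemma resolvent_exists:
  fixes B :: "'a::banach \<Rightarrow>\<^sub>L 'a"
  assumes "norm B < \<mu>"
  shows "resolvent B \<mu> o\<^sub>L (\<mu> *\<^sub>R id_blinfun - B) = id_blinfun"
    and "(\<mu> *\<^sub>R id_blinfun - B) o\<^sub>L resolvent B \<mu> = id_blinfun"
proof -
  define T where "T x = \<mu> *\<^sub>R x - blinfun_apply B x" for x
  have \<mu>: "0 < \<mu>" using assms norm_ge_zero[of B] by linarith
  have T_eq: "blinfun_apply (\<mu> *\<^sub>R id_blinfun - B) x = T x" for x
    by (simp add: T_def blinfun.diff_left blinfun.scaleR_left)
  have T_lin: "T (x + y) = T x + T y" "T (c *\<^sub>R x) = c *\<^sub>R T x" "T (x - y) = T x - T y" for x y c
    by (simp_all add: T_def blinfun.add_right blinfun.scaleR_right blinfun.diff_right algebra_simps)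
  have lower: "(\<mu> - norm B) * norm x \<le> norm (T x)" for x
  proof -
    have "\<mu> * norm x - norm (blinfun_apply B x) \<le> norm (T x)"
      using norm_triangle_ineq2[of "\<mu> *\<^sub>R x" "blinfun_apply B x"] \<mu> by (simp add: T_def)
    moreover have "norm (blinfun_apply B x) \<le> norm B * norm x" by (rule norm_blinfun)
    ultimately show ?thesis by (simp add: algebra_simps)
  qed
  have inj: "x = y" if "T x = T y" for x y
  proof -
    have "(\<mu> - norm B) * norm (x - y) \<le> 0"
      using lower[of "x - y"] that by (simp add: T_lin)
    hence "norm (x - y) \<le> 0" using assms by (simp add: mult_le_0_iff)
    thus ?thesis by simp
  qed
  have surj: "\<exists>x. T x = y" for y
  proof -
    have "\<exists>!x. (y + blinfun_apply B x) /\<^sub>R \<mu> = x"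
    proof (rule banach_fix_type[where c = "norm B / \<mu>"]; (intro allI)?)
      show "norm B / \<mu> < 1" "0 \<le> norm B / \<mu>" using assms \<mu> by auto
      fix u v
      have "(y + blinfun_apply B u) /\<^sub>R \<mu> - (y + blinfun_apply B v) /\<^sub>R \<mu> = blinfun_apply B (u - v) /\<^sub>R \<mu>"
        by (simp add: blinfun.diff_right algebra_simps)
      thus "dist ((y + blinfun_apply B u) /\<^sub>R \<mu>) ((y + blinfun_apply B v) /\<^sub>R \<mu>) \<le> norm B / \<mu> * dist u v"
        using norm_blinfun[of B "u - v"] \<mu> by (simp add: dist_norm field_simps)
    qed
    then obtain x where "(y + blinfun_apply B x) /\<^sub>R \<mu> = x" by auto
    hence "\<mu> *\<^sub>R x = y + blinfun_apply B x"
      using \<mu> by (metis less_irrefl scaleR_one scaleR_scaleR right_inverse)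
    hence "T x = y" by (simp add: T_def)
    thus ?thesis ..
  qed
  define R where "R = inv T"
  have TR: "T (R y) = y" for y using surj[of y] by (metis R_def f_inv_into_f rangeI)
  have "bounded_linear R"
  proof (rule bounded_linear_intro[where K = "1 / (\<mu> - norm B)"])
    show "R (x + y) = R x + R y" "R (c *\<^sub>R x) = c *\<^sub>R R x" for x y c
      by (rule inj, simp add: TR T_lin)+
    show "norm (R x) \<le> norm x * (1 / (\<mu> - norm B))" for x
      using lower[of "R x"] assms by (simp add: TR field_simps)
  qed
  hence R: "blinfun_apply (Blinfun R) = R" by (rule bounded_linear_Blinfun_apply)
  have 1: "Blinfun R o\<^sub>L (\<mu> *\<^sub>R id_blinfun - B) = id_blinfun"
    by (rule blinfun_eqI) (simp add: R T_eq, rule inj, rule TR)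
  have 2: "(\<mu> *\<^sub>R id_blinfun - B) o\<^sub>L Blinfun R = id_blinfun"
    by (rule blinfun_eqI) (simp add: R T_eq TR)
  show "resolvent B \<mu> o\<^sub>L (\<mu> *\<^sub>R id_blinfun - B) = id_blinfun"
    "(\<mu> *\<^sub>R id_blinfun - B) o\<^sub>L resolvent B \<mu> = id_blinfun"
    using 1 2 resolvent_eqI[OF 1 2] by simp_all
qed

definition ell2_on :: "'v set \<Rightarrow> 'v ell2 set"
  where "ell2_on S = {f. \<forall>x. x \<notin> S \<longrightarrow> ell2_apply f x = 0}"

lemma orthogonal_projection_ell2_on_apply:
  "ell2_apply (blinfun_apply (orthogonal_projection (ell2_on S)) f) x
     = (if x \<in> S then ell2_apply f x else 0)"
proof -
  define r where "r f = Abs_ell2 (\<lambda>x. if x \<in> S then ell2_apply f x else 0)" for f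
  have r: "ell2_apply (r f) x = (if x \<in> S then ell2_apply f x else 0)" for f x
  proof -
    have "(\<lambda>x. (cmod (if x \<in> S then ell2_apply f x else 0))\<^sup>2) summable_on UNIV"
      using ell2_summable[of f] by (rule summable_on_comparison_test) auto
    thus ?thesis by (simp add: r_def Abs_ell2_inverse)
  qed
  have orth: "orthogonal (f - r f) h" if "h \<in> ell2_on S" for f h
  proof -
    have "ell2_apply (f - r f) y \<bullet> ell2_apply h y = 0" for y
      using that by (auto simp: ell2_on_def minus_ell2.rep_eq r)
    thus ?thesis by (simp add: orthogonal_def inner_ell2_def)
  qed
  have "(THE g. g \<in> ell2_on S \<and> (\<forall>h\<in>ell2_on S. orthogonal (f - g) h)) = r f" for f
  proof (rule the_equality)
    show "r f \<in> ell2_on S \<and> (\<forall>h\<in>ell2_on S. orthogonal (f - r f) h)"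
      using orth by (auto simp: ell2_on_def r)
    fix g assume g: "g \<in> ell2_on S \<and> (\<forall>h\<in>ell2_on S. orthogonal (f - g) h)"
    have "g - r f \<in> ell2_on S" using g by (auto simp: ell2_on_def r minus_ell2.rep_eq)
    hence "(f - r f) \<bullet> (g - r f) = 0" "(f - g) \<bullet> (g - r f) = 0"
      using g orth by (auto simp: orthogonal_def)
    hence "(g - r f) \<bullet> (g - r f) = 0" by (simp add: inner_diff_left)
    thus "g = r f" by simp
  qed
  hence eq: "orthogonal_projection (ell2_on S) = Blinfun r"
    by (simp add: orthogonal_projection_def)
  have "bounded_linear r"
  proof (rule bounded_linear_intro[where K = 1])
    fix f g :: "'a ell2" and c :: real
    show "r (f + g) = r f + r g" by (rule ell2_eqI) (simp add: r plus_ell2.rep_eq)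
    show "r (c *\<^sub>R f) = c *\<^sub>R r f" by (rule ell2_eqI) (simp add: r scaleR_ell2.rep_eq)
    have "(\<Sum>\<^sub>\<infinity>x. (cmod (ell2_apply (r f) x))\<^sup>2) \<le> (\<Sum>\<^sub>\<infinity>x. (cmod (ell2_apply f x))\<^sup>2)"
      by (rule infsum_mono) (simp_all add: ell2_summable, simp add: r)
    thus "norm (r f) \<le> norm f * 1" by (simp add: norm_ell2_def)
  qed
  thus ?thesis by (simp add: eq bounded_linear_Blinfun_apply r)
qed

section \<open>Undirected graphs\<close>

text \<open>The vertex set is the whole type \<^typ>\<open>'v\<close>. Edges have identities, so multiple edges are
  possible; \<open>ends e\<close> is the set of end vertices of \<open>e\<close>, a singleton for a self-loop.\<close>

record ('v, 'e) ugraph =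
  edges :: "'e set"
  ends :: "'e \<Rightarrow> 'v set"

definition wf_ugraph :: "('v, 'e) ugraph \<Rightarrow> bool"
  where "wf_ugraph G \<longleftrightarrow> (\<forall>e\<in>edges G. \<exists>x y. ends G e = {x, y})"

definition adj_entry :: "('v, 'e) ugraph \<Rightarrow> 'v \<Rightarrow> 'v \<Rightarrow> nat"
  where "adj_entry G x y = card {e \<in> edges G. ends G e = {x, y}}"

definition incident :: "('v, 'e) ugraph \<Rightarrow> 'v \<Rightarrow> 'e set"
  where "incident G x = {e \<in> edges G. x \<in> ends G e}"

text \<open>Meaningful for graphs of bounded degree, see \<open>adjacency_operator_apply\<close> below; there the sum
  over \<open>y\<close> has finite support.\<close>

definition adjacency_operator :: "('v, 'e) ugraph \<Rightarrow> 'v ell2 \<Rightarrow>\<^sub>L 'v ell2"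
  where "adjacency_operator G =
    Blinfun (\<lambda>f. Abs_ell2 (\<lambda>x. \<Sum>\<^sub>\<infinity>y. of_nat (adj_entry G x y) * ell2_apply f y))"

text \<open>\<open>walk G x p y\<close>: the list \<open>p\<close> of pairs (edge traversed, vertex reached) leads from \<open>x\<close> to \<open>y\<close>.\<close>

fun walk :: "('v, 'e) ugraph \<Rightarrow> 'v \<Rightarrow> ('e \<times> 'v) list \<Rightarrow> 'v \<Rightarrow> bool"
  where
    "walk G x [] y \<longleftrightarrow> x = y"
  | "walk G x ((e, z) # p) y \<longleftrightarrow> e \<in> edges G \<and> ends G e = {x, z} \<and> walk G z p y"

text \<open>Distinctness of the edges excludes walking an edge back and forth, whereas a self-loop and a
  pair of parallel edges are cycles.\<close>

definition is_cycle :: "('v, 'e) ugraph \<Rightarrow> 'v \<Rightarrow> ('e \<times> 'v) list \<Rightarrow> bool"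
  where "is_cycle G x p \<longleftrightarrow>
    p \<noteq> [] \<and> walk G x p x \<and> distinct (map fst p) \<and> distinct (map snd p)"

definition is_tree :: "('v, 'e) ugraph \<Rightarrow> bool"
  where "is_tree G \<longleftrightarrow>
    wf_ugraph G \<and> (\<forall>x y. \<exists>p. walk G x p y) \<and> \<not> (\<exists>x p. is_cycle G x p)"

definition is_Cayley_tree :: "nat \<Rightarrow> ('v, 'e) ugraph \<Rightarrow> bool"
  where "is_Cayley_tree Q G \<longleftrightarrow>
    is_tree G \<and> infinite (UNIV :: 'v set) \<and>
    (\<forall>x. finite (incident G x) \<and> card (incident G x) = Q)"

definition add_loops :: "('v, 'e) ugraph \<Rightarrow> 'v set \<Rightarrow> ('v, 'e + 'v) ugraph"
  where "add_loops G S =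
    \<lparr>edges = Inl ` edges G \<union> Inr ` S, ends = case_sum (ends G) (\<lambda>x. {x})\<rparr>"

lemma adj_entry_add_loops:
  assumes "\<And>x. finite (incident G x)"
  shows "adj_entry (add_loops G S) x y = adj_entry G x y + (if x = y \<and> x \<in> S then 1 else 0)"
proof -
  have "e \<in> edges (add_loops G S) \<and> ends (add_loops G S) e = {x, y} \<longleftrightarrow>
    e \<in> Inl ` {e \<in> edges G. ends G e = {x, y}} \<union> (if x = y \<and> x \<in> S then {Inr x} else {})" for e
    by (cases e) (auto simp: add_loops_def)
  hence "{e \<in> edges (add_loops G S). ends (add_loops G S) e = {x, y}} =
    Inl ` {e \<in> edges G. ends G e = {x, y}} \<union> (if x = y \<and> x \<in> S then {Inr x} else {})"
    by blast
  moreover have "finite {e \<in> edges G. ends G e = {x, y}}"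
    by (rule finite_subset[OF _ assms[of x]]) (auto simp: incident_def)
  ultimately show ?thesis
    by (auto simp: adj_entry_def card_image card_insert_if)
qed

text \<open>The adjacency operator of a graph of bounded degree is bounded, so that its definition by
  means of \<^const>\<open>Blinfun\<close> and \<^const>\<open>Abs_ell2\<close> is meaningful.\<close>

lemma adjacency_operator_apply:
  fixes G :: "('v, 'e) ugraph" and d :: nat
  assumes fin: "\<And>x. finite (incident G x)" and deg: "\<And>x. card (incident G x) \<le> d"
  assumes wf: "wf_ugraph G"
  shows "ell2_apply (blinfun_apply (adjacency_operator G) f) x =
    (\<Sum>\<^sub>\<infinity>y. of_nat (adj_entry G x y) * ell2_apply f y)"
proof -
  define N where "N x = {y. adj_entry G x y \<noteq> 0}" for x
  have fine: "finite {e \<in> edges G. ends G e = {x, y}}" for x y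
    by (rule finite_subset[OF _ fin[of x]]) (auto simp: incident_def)
  have finN: "finite (N x)" for x
  proof (rule finite_subset)
    show "N x \<subseteq> (\<Union>e\<in>incident G x. ends G e)"
    proof
      fix y assume "y \<in> N x"
      hence "{e \<in> edges G. ends G e = {x, y}} \<noteq> {}"
        unfolding N_def adj_entry_def by (metis (mono_tags) card.empty mem_Collect_eq)
      thus "y \<in> (\<Union>e\<in>incident G x. ends G e)" by (auto simp: incident_def)
    qed
    show "finite (\<Union>e\<in>incident G x. ends G e)"
    proof (intro finite_UN_I fin)
      fix e assume "e \<in> incident G x"
      then obtain a b where "ends G e = {a, b}" using wf by (auto simp: incident_def wf_ugraph_def)
      thus "finite (ends G e)" by simp
    qed
  qed
  have sym: "adj_entry G x y = adj_entry G y x" for x y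
    by (simp add: adj_entry_def insert_commute)
  have rowsum: "(\<Sum>y\<in>F. adj_entry G x y) \<le> d" if "finite F" for F x
  proof -
    have "(\<Sum>y\<in>F. adj_entry G x y) = card (\<Union>y\<in>F. {e \<in> edges G. ends G e = {x, y}})"
      unfolding adj_entry_def
      by (rule card_UN_disjoint[symmetric]) (use that fine in \<open>auto simp: doubleton_eq_iff\<close>)
    also have "\<dots> \<le> card (incident G x)"
      by (rule card_mono[OF fin]) (auto simp: incident_def)
    finally show ?thesis using deg[of x] by linarith
  qed
  define A where "A x y = real (adj_entry G x y)" for x y
  have A0: "A x y \<ge> 0" for x y by (simp add: A_def)
  have rowA: "(\<Sum>y\<in>F. A x y) \<le> d" if "finite F" for F x
    using rowsum[OF that, of x] unfolding A_def of_nat_sum[symmetric] by (rule of_nat_mono)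
  define T where "T f x = (\<Sum>\<^sub>\<infinity>y. of_nat (adj_entry G x y) * ell2_apply f y)" for f x
  have T: "T f x = (\<Sum>y\<in>N x. A x y *\<^sub>R ell2_apply f y)" for f x
  proof -
    have "T f x = (\<Sum>\<^sub>\<infinity>y\<in>N x. A x y *\<^sub>R ell2_apply f y)"
      unfolding T_def by (rule infsum_cong_neutral) (auto simp: N_def A_def scaleR_conv_of_real)
    thus ?thesis using finN by simp
  qed
  have row: "(cmod (T f x))\<^sup>2 \<le> d * (\<Sum>y\<in>N x. A x y * (cmod (ell2_apply f y))\<^sup>2)" for f x
  proof -
    have "cmod (T f x) \<le> (\<Sum>y\<in>N x. A x y * cmod (ell2_apply f y))"
      unfolding T by (rule sum_norm_le) (simp add: A0)
    also have "\<dots> = (\<Sum>y\<in>N x. sqrt (A x y) * (sqrt (A x y) * cmod (ell2_apply f y)))"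
      by (simp add: A0 mult.assoc[symmetric])
    finally have "(cmod (T f x))\<^sup>2 \<le> \<dots>\<^sup>2" by (rule power_mono) simp
    also have "\<dots> \<le> (\<Sum>y\<in>N x. (sqrt (A x y))\<^sup>2) * (\<Sum>y\<in>N x. (sqrt (A x y) * cmod (ell2_apply f y))\<^sup>2)"
      by (rule Cauchy_Schwarz_ineq_sum)
    also have "\<dots> = (\<Sum>y\<in>N x. A x y) * (\<Sum>y\<in>N x. A x y * (cmod (ell2_apply f y))\<^sup>2)"
      by (simp add: A0 power_mult_distrib)
    also have "\<dots> \<le> d * (\<Sum>y\<in>N x. A x y * (cmod (ell2_apply f y))\<^sup>2)"
      by (intro mult_right_mono rowA finN sum_nonneg mult_nonneg_nonneg A0) auto
    finally show ?thesis .
  qed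
  have bound: "(\<Sum>x\<in>F. (cmod (T f x))\<^sup>2) \<le> (d * norm f)\<^sup>2" if F: "finite F" for f F
  proof -
    let ?M = "\<Union>x\<in>F. N x"
    have finM: "finite ?M" using F finN by auto
    have "(\<Sum>x\<in>F. (cmod (T f x))\<^sup>2) \<le> (\<Sum>x\<in>F. d * (\<Sum>y\<in>N x. A x y * (cmod (ell2_apply f y))\<^sup>2))"
      by (intro sum_mono row)
    also have "\<dots> \<le> (\<Sum>x\<in>F. d * (\<Sum>y\<in>?M. A x y * (cmod (ell2_apply f y))\<^sup>2))"
      by (intro sum_mono mult_left_mono sum_mono2 finM mult_nonneg_nonneg A0) auto
    also have "\<dots> = d * (\<Sum>y\<in>?M. (\<Sum>x\<in>F. A y x) * (cmod (ell2_apply f y))\<^sup>2)"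
      unfolding sum_distrib_left[symmetric] sum_distrib_right A_def
      by (subst sum.swap) (simp add: sym)
    also have "\<dots> \<le> d * (\<Sum>y\<in>?M. d * (cmod (ell2_apply f y))\<^sup>2)"
      by (intro mult_left_mono sum_mono mult_right_mono rowA F) auto
    also have "\<dots> = (real d)\<^sup>2 * (\<Sum>y\<in>?M. (cmod (ell2_apply f y))\<^sup>2)"
      by (simp add: sum_distrib_left power2_eq_square mult.assoc)
    also have "(\<Sum>y\<in>?M. (cmod (ell2_apply f y))\<^sup>2) \<le> (norm f)\<^sup>2"
      by (rule norm_ell2_sum_le[OF finM])
    finally show ?thesis by (simp add: power_mult_distrib mult_left_mono)
  qed
  note T_bound = ell2_boundedI[of "T f" "d * norm f" for f, OF bound]
  have app: "ell2_apply (Abs_ell2 (T f)) = T f" for f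
    by (rule T_bound(2)) auto
  have "bounded_linear (\<lambda>f. Abs_ell2 (T f))"
  proof (rule bounded_linear_intro[where K = d])
    fix f g :: "'v ell2" and c :: real
    show "Abs_ell2 (T (f + g)) = Abs_ell2 (T f) + Abs_ell2 (T g)"
      by (rule ell2_eqI) (simp add: app T plus_ell2.rep_eq scaleR_add_right sum.distrib)
    show "Abs_ell2 (T (c *\<^sub>R f)) = c *\<^sub>R Abs_ell2 (T f)"
      by (rule ell2_eqI) (simp add: app T scaleR_ell2.rep_eq scaleR_sum_right mult.commute)
    show "norm (Abs_ell2 (T f)) \<le> norm f * d"
      using T_bound(3)[of f] by (simp add: mult.commute)
  qed
  hence "blinfun_apply (adjacency_operator G) = (\<lambda>f. Abs_ell2 (T f))"
    unfolding adjacency_operator_def T_def[abs_def] by (rule bounded_linear_Blinfun_apply)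
  thus ?thesis by (simp add: app) (simp add: T_def)
qed

end

theory Submission
  imports Defs
begin

text \<open>Write \<open>A\<close> for the adjacency operator of the tree, so that \<open>A\<^sub>Y = A + P\<close>, and let
  \<open>\<mu> > \<parallel>A\<parallel>\<close>. In the order of quadratic forms, \<open>\<parallel>P R\<^sub>A(\<mu>) P\<parallel> \<le> c\<close> is equivalent to
  \<open>P \<le> c (\<mu> - A)\<close> for every \<open>c > 0\<close>. For \<open>c = 1\<close> this says \<open>A + P \<le> \<mu>\<close>, which is \<open>\<parallel>A\<^sub>Y\<parallel> \<le> \<mu>\<close> since
  \<open>A + P \<ge> - \<parallel>A\<parallel>\<close>. Because \<open>- \<parallel>A\<parallel> \<le> A \<le> \<parallel>A\<parallel>\<close>, the inequality holds with some \<open>c < 1\<close> if and only if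
  \<open>A + P \<le> \<nu>\<close> for some \<open>\<nu> < \<mu>\<close>; hence \<open>\<parallel>P R\<^sub>A(\<mu>) P\<parallel> = 1\<close> if and only if \<open>\<parallel>A\<^sub>Y\<parallel> = \<mu>\<close>.\<close>

section \<open>Quadratic forms of symmetric operators\<close>

definition symmetric_op :: "('a::real_inner \<Rightarrow>\<^sub>L 'a) \<Rightarrow> bool"
  where "symmetric_op T \<longleftrightarrow> (\<forall>x y. blinfun_apply T x \<bullet> y = x \<bullet> blinfun_apply T y)"

lemma symmetric_opD: "symmetric_op T \<Longrightarrow> blinfun_apply T x \<bullet> y = x \<bullet> blinfun_apply T y"
  by (simp add: symmetric_op_def)

lemma symmetric_op_add: "symmetric_op S \<Longrightarrow> symmetric_op T \<Longrightarrow> symmetric_op (S + T)"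
  by (simp add: symmetric_op_def blinfun.add_left inner_add_left inner_add_right)

lemma abs_quadratic_form_le:
  fixes T :: "'a::real_inner \<Rightarrow>\<^sub>L 'a"
  shows "\<bar>blinfun_apply T x \<bullet> x\<bar> \<le> norm T * (norm x)\<^sup>2"
proof -
  have "\<bar>blinfun_apply T x \<bullet> x\<bar> \<le> norm (blinfun_apply T x) * norm x"
    by (rule Cauchy_Schwarz_ineq2)
  also have "\<dots> \<le> norm T * norm x * norm x"
    by (intro mult_right_mono norm_blinfun) auto
  finally show ?thesis by (simp add: power2_eq_square mult.assoc)
qed

text \<open>Polarization turns \<open>4 * (T x \<bullet> y)\<close> into a difference of two values
  of the form, and the parallelogram law controls their bounds. This is how norms of symmetric
  operators are reduced to form inequalities below.\<close>

lemma norm_le_of_quadratic_form: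
  fixes T :: "'a::real_inner \<Rightarrow>\<^sub>L 'a"
  assumes sym: "symmetric_op T" and "0 \<le> c"
    and form: "\<And>x. \<bar>blinfun_apply T x \<bullet> x\<bar> \<le> c * (norm x)\<^sup>2"
  shows "norm T \<le> c"
proof (rule norm_blinfun_bound[OF \<open>0 \<le> c\<close>])
  fix x
  define z where "z = blinfun_apply T x"
  show "norm (blinfun_apply T x) \<le> c * norm x"
  proof (cases "z = 0 \<or> x = 0")
    case True
    then show ?thesis using \<open>0 \<le> c\<close> by (auto simp: z_def blinfun.zero_right)
  next
    case False
    \<comment> \<open>\<open>y\<close> is \<open>T x\<close> rescaled to the length of
      \<open>x\<close>: then \<open>z \<bullet> y\<close> is the full product of norms and the
      parallelogram sum is \<open>4 * (norm x)\<^sup>2\<close>.\<close>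
    define y where "y = (norm x / norm z) *\<^sub>R z"
    have ny: "norm y = norm x" using False by (simp add: y_def)
    have zy: "z \<bullet> y = norm x * norm z"
      using False by (simp add: y_def dot_square_norm power2_eq_square)
    have "4 * (z \<bullet> y) = blinfun_apply T (x + y) \<bullet> (x + y) - blinfun_apply T (x - y) \<bullet> (x - y)"
      using symmetric_opD[OF sym, of y x]
      by (simp add: z_def blinfun.add_right blinfun.diff_right inner_add_left inner_add_right
          inner_diff_left inner_diff_right inner_commute)
    also have "\<dots> \<le> c * ((norm (x + y))\<^sup>2 + (norm (x - y))\<^sup>2)"
      using form[of "x + y"] form[of "x - y"] by (simp add: distrib_left)
    also have "(norm (x + y))\<^sup>2 + (norm (x - y))\<^sup>2 = 4 * (norm x)\<^sup>2"
    proof -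
      have "(norm (x + y))\<^sup>2 + (norm (x - y))\<^sup>2 = 2 * (norm x)\<^sup>2 + 2 * (norm y)\<^sup>2"
        by (simp add: power2_norm_eq_inner inner_add_left inner_add_right inner_diff_left
            inner_diff_right)
      then show ?thesis by (simp add: ny)
    qed
    finally have "norm x * norm z \<le> norm x * (c * norm x)"
      by (simp add: zy power2_eq_square mult_ac)
    then show ?thesis using False by (simp add: z_def)
  qed
qed

section \<open>Perturbation of a symmetric operator by a projection\<close>

text \<open>A symmetric idempotent is the orthogonal projection onto its range. Completeness of the
  space provides the resolvent above \<open>norm A\<close>.\<close>

locale projection_perturbation =
  fixes A P :: "'a::{real_inner, banach} \<Rightarrow>\<^sub>L 'a"
  assumes symA: "symmetric_op A" and symP: "symmetric_op P"
    and idem: "blinfun_apply P (blinfun_apply P x) = blinfun_apply P x"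
begin

lemma form_P: "blinfun_apply P x \<bullet> x = (norm (blinfun_apply P x))\<^sup>2"
  by (metis idem power2_norm_eq_inner symP symmetric_opD)

text \<open>Only the upper half of the two-sided form bound carries information, since
  \<open>P\<close> has a nonnegative form and that of \<open>A\<close> is at least
  \<open>- norm A\<close>. The case \<mu> = \<open>norm A\<close> is included because the threshold
  \<nu> chosen later may equal \<open>norm A\<close>.\<close>

lemma norm_sum_le_iff:
  assumes "norm A \<le> \<mu>"
  shows "norm (A + P) \<le> \<mu> \<longleftrightarrow>
    (\<forall>x. blinfun_apply A x \<bullet> x + (norm (blinfun_apply P x))\<^sup>2 \<le> \<mu> * (norm x)\<^sup>2)"
proof -
  have eq: "blinfun_apply (A + P) x \<bullet> x = blinfun_apply A x \<bullet> x + (norm (blinfun_apply P x))\<^sup>2" for x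
    by (simp add: blinfun.add_left inner_add_left form_P)
  have lower: "- (\<mu> * (norm x)\<^sup>2) \<le> blinfun_apply (A + P) x \<bullet> x" for x
  proof -
    have "- (\<mu> * (norm x)\<^sup>2) \<le> - (norm A * (norm x)\<^sup>2)"
      using assms by (simp add: mult_right_mono)
    also have "\<dots> \<le> blinfun_apply A x \<bullet> x"
      using abs_quadratic_form_le[of A x] by linarith
    also have "\<dots> \<le> blinfun_apply (A + P) x \<bullet> x" by (simp add: eq)
    finally show ?thesis .
  qed
  show ?thesis
  proof
    assume le: "norm (A + P) \<le> \<mu>"
    show "\<forall>x. blinfun_apply A x \<bullet> x + (norm (blinfun_apply P x))\<^sup>2 \<le> \<mu> * (norm x)\<^sup>2"
    proof
      fix x
      have "blinfun_apply (A + P) x \<bullet> x \<le> norm (A + P) * (norm x)\<^sup>2"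
        using abs_quadratic_form_le[of "A + P" x] by linarith
      also have "\<dots> \<le> \<mu> * (norm x)\<^sup>2" using le by (simp add: mult_right_mono)
      finally show "blinfun_apply A x \<bullet> x + (norm (blinfun_apply P x))\<^sup>2 \<le> \<mu> * (norm x)\<^sup>2"
        by (simp add: eq)
    qed
  next
    assume le: "\<forall>x. blinfun_apply A x \<bullet> x + (norm (blinfun_apply P x))\<^sup>2 \<le> \<mu> * (norm x)\<^sup>2"
    show "norm (A + P) \<le> \<mu>"
    proof (rule norm_le_of_quadratic_form[OF symmetric_op_add[OF symA symP]])
      show "0 \<le> \<mu>" using assms norm_ge_zero order_trans by blast
      show "\<bar>blinfun_apply (A + P) x \<bullet> x\<bar> \<le> \<mu> * (norm x)\<^sup>2" for x
        using lower[of x] le[rule_format, of x] eq[of x] by linarith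
    qed
  qed
qed

text \<open>With \<open>B\<close> = \<mu> - \<open>A\<close>, which has a nonnegative form, one
  direction completes a square in the form of \<open>B\<close>; the other tests the form inequality
  at \<open>R (P x)\<close>. No square root of \<open>B\<close> is needed.\<close>

lemma norm_compressed_resolvent_le_iff:
  assumes \<mu>: "norm A < \<mu>" and c: "0 < c"
  shows "norm (P o\<^sub>L resolvent A \<mu> o\<^sub>L P) \<le> c \<longleftrightarrow>
    (\<forall>x. (norm (blinfun_apply P x))\<^sup>2 \<le> c * (\<mu> * (norm x)\<^sup>2 - blinfun_apply A x \<bullet> x))"
proof -
  define B where "B x = \<mu> *\<^sub>R x - blinfun_apply A x" for x
  define R where "R = blinfun_apply (resolvent A \<mu>)"
  have BR: "B (R x) = x" for x
    using arg_cong[OF resolvent_exists(2)[OF \<mu>], of "\<lambda>T. blinfun_apply T x"]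
    by (simp add: B_def R_def blinfun.diff_left blinfun.scaleR_left)
  have B_diff: "B (x - y) = B x - B y" for x y
    by (simp add: B_def blinfun.diff_right scaleR_diff_right)
  have B_scale: "B (t *\<^sub>R x) = t *\<^sub>R B x" for t x
    by (simp add: B_def blinfun.scaleR_right scaleR_diff_right)
  have B_sym: "B x \<bullet> y = x \<bullet> B y" for x y
    by (simp add: B_def inner_diff_left inner_diff_right symmetric_opD[OF symA])
  have form_B: "B x \<bullet> x = \<mu> * (norm x)\<^sup>2 - blinfun_apply A x \<bullet> x" for x
    by (simp add: B_def inner_diff_left power2_norm_eq_inner)
  have B_nonneg: "0 \<le> B x \<bullet> x" for x
  proof -
    have "blinfun_apply A x \<bullet> x \<le> norm A * (norm x)\<^sup>2"
      using abs_quadratic_form_le[of A x] by linarith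
    also have "\<dots> \<le> \<mu> * (norm x)\<^sup>2" using \<mu> by (simp add: mult_right_mono)
    finally show ?thesis by (simp add: form_B)
  qed
  show ?thesis
  proof
    assume le: "norm (P o\<^sub>L resolvent A \<mu> o\<^sub>L P) \<le> c"
    show "\<forall>x. (norm (blinfun_apply P x))\<^sup>2 \<le> c * (\<mu> * (norm x)\<^sup>2 - blinfun_apply A x \<bullet> x)"
    proof
      fix x
      define h where "h = blinfun_apply P x"
      have Ph: "blinfun_apply P h = h" by (simp add: h_def idem)
      have hx: "h \<bullet> x = (norm h)\<^sup>2" by (simp add: h_def form_P)
      \<comment> \<open>Since \<open>P h = h\<close>, this is the form of the compressed resolvent
        at \<open>h\<close>.\<close>
      have "R h \<bullet> h = blinfun_apply P (R (blinfun_apply P h)) \<bullet> h"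
        using symmetric_opD[OF symP, of "R h" h] by (simp add: Ph)
      also have "\<dots> \<le> c * (norm h)\<^sup>2"
      proof -
        have "blinfun_apply (P o\<^sub>L resolvent A \<mu> o\<^sub>L P) h \<bullet> h
            \<le> norm (P o\<^sub>L resolvent A \<mu> o\<^sub>L P) * (norm h)\<^sup>2"
          by (rule order_trans[OF abs_ge_self abs_quadratic_form_le])
        also have "\<dots> \<le> c * (norm h)\<^sup>2" using le by (simp add: mult_right_mono)
        finally show ?thesis by (simp add: R_def)
      qed
      finally have Rh: "R h \<bullet> h \<le> c * (norm h)\<^sup>2" .
      \<comment> \<open>The value \<open>1 / c\<close> minimizes
        \<open>- 2 * t + t\<^sup>2 * c\<close>, the coefficient of \<open>(norm h)\<^sup>2\<close>
        in the estimate below.\<close>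
      define t where "t = 1 / c"
      have "0 \<le> B (x - t *\<^sub>R R h) \<bullet> (x - t *\<^sub>R R h)" by (rule B_nonneg)
      also have "\<dots> = B x \<bullet> x - 2 * t * (norm h)\<^sup>2 + t\<^sup>2 * (R h \<bullet> h)"
        using B_sym[of x "R h"] hx
        by (simp add: B_diff B_scale BR inner_diff_left inner_diff_right inner_commute
            power2_eq_square algebra_simps)
      also have "\<dots> \<le> B x \<bullet> x - 2 * t * (norm h)\<^sup>2 + t\<^sup>2 * (c * (norm h)\<^sup>2)"
        using Rh by (simp add: mult_left_mono)
      also have "\<dots> = B x \<bullet> x - (norm h)\<^sup>2 / c"
        using c by (simp add: t_def power2_eq_square field_simps)
      finally have "(norm h)\<^sup>2 \<le> c * (B x \<bullet> x)" using c by (simp add: field_simps)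
      then show "(norm (blinfun_apply P x))\<^sup>2 \<le> c * (\<mu> * (norm x)\<^sup>2 - blinfun_apply A x \<bullet> x)"
        by (simp add: h_def form_B)
    qed
  next
    assume le: "\<forall>x. (norm (blinfun_apply P x))\<^sup>2
      \<le> c * (\<mu> * (norm x)\<^sup>2 - blinfun_apply A x \<bullet> x)"
    show "norm (P o\<^sub>L resolvent A \<mu> o\<^sub>L P) \<le> c"
    proof (rule norm_blinfun_bound)
      fix x
      \<comment> \<open>As \<open>B g = P x\<close>, the form of \<open>B\<close> at
        \<open>g\<close> collapses to \<open>P g \<bullet> x\<close>; Cauchy-Schwarz then leaves one
        factor \<open>norm p\<close> to cancel.\<close>
      define g where "g = R (blinfun_apply P x)"
      define p where "p = blinfun_apply P g"
      have "(norm p)\<^sup>2 \<le> c * (B g \<bullet> g)" using le by (simp add: p_def form_B)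
      also have "B g \<bullet> g = p \<bullet> x"
        using symmetric_opD[OF symP, of x g] by (simp add: g_def BR p_def inner_commute)
      also have "c * (p \<bullet> x) \<le> c * (norm p * norm x)"
        using c norm_cauchy_schwarz[of p x] by simp
      finally have "norm p * norm p \<le> norm p * (c * norm x)"
        by (simp add: power2_eq_square mult_ac)
      then have "norm p \<le> c * norm x"
        using c by (cases "p = 0") auto
      then show "norm (blinfun_apply (P o\<^sub>L resolvent A \<mu> o\<^sub>L P) x) \<le> c * norm x"
        by (simp add: p_def g_def R_def)
    qed (use c in simp)
  qed
qed

text \<open>Equality is obtained by combining the equivalence of the non-strict inequalities with
  that of the strict ones. For the latter, a gap between \<open>c\<close> and 1 is traded for a gap
  between \<nu> and \<mu>.\<close>

theorem norm_compressed_resolvent_eq_1_iff: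
  assumes \<mu>: "norm A < \<mu>"
  shows "norm (P o\<^sub>L resolvent A \<mu> o\<^sub>L P) = 1 \<longleftrightarrow> norm (A + P) = \<mu>"
proof -
  let ?N = "norm (P o\<^sub>L resolvent A \<mu> o\<^sub>L P)" and ?a = "norm A"
  have a: "\<bar>blinfun_apply A x \<bullet> x\<bar> \<le> ?a * (norm x)\<^sup>2" for x
    by (rule abs_quadratic_form_le)
  have le: "?N \<le> 1 \<longleftrightarrow> norm (A + P) \<le> \<mu>"
    using norm_compressed_resolvent_le_iff[OF \<mu>, of 1] norm_sum_le_iff[of \<mu>] \<mu>
    by (simp add: algebra_simps)
  have "?N < 1" if "norm (A + P) < \<mu>"
  proof -
    \<comment> \<open>The bound \<open>norm A\<close> makes \<open>norm_sum_le_iff\<close>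
      applicable at \<nu>; \<mu>/2 keeps \<nu>, and hence \<open>c\<close>, positive even if both
      norms vanish.\<close>
    define \<nu> where "\<nu> = max (norm (A + P)) (max ?a (\<mu> / 2))"
    have "0 < \<mu>" using \<mu> norm_ge_zero[of A] by linarith
    then have \<nu>: "norm (A + P) \<le> \<nu>" "?a \<le> \<nu>" "0 < \<nu>" "\<nu> < \<mu>"
      using that \<mu> by (auto simp: \<nu>_def)
    \<comment> \<open>The least \<open>c\<close> with \<nu> - s \<le> \<open>c\<close> (\<mu> - s)
      for all s in [\<open>-norm A\<close>, \<open>norm A\<close>]; the extreme case is s =
      \<open>-norm A\<close>.\<close>
    define c where "c = (\<nu> + ?a) / (\<mu> + ?a)"
    have pos: "0 < \<mu> + ?a" "0 < \<nu> + ?a"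
      using \<nu> \<open>0 < \<mu>\<close> by (auto intro: add_pos_nonneg)
    have c: "0 < c" "c < 1" using pos \<nu> by (simp_all add: c_def)
    have "c * (\<mu> + ?a) = \<nu> + ?a" using pos by (simp add: c_def)
    then have c_eq: "\<nu> = c * \<mu> - (1 - c) * ?a" by (simp add: algebra_simps)
    have "(norm (blinfun_apply P x))\<^sup>2 \<le> c * (\<mu> * (norm x)\<^sup>2 - blinfun_apply A x \<bullet> x)" for x
    proof -
      have "(norm (blinfun_apply P x))\<^sup>2 \<le> \<nu> * (norm x)\<^sup>2 - blinfun_apply A x \<bullet> x"
        using norm_sum_le_iff[OF \<nu>(2)] \<nu>(1) by (simp add: algebra_simps)
      also have "\<dots> = c * (\<mu> * (norm x)\<^sup>2 - blinfun_apply A x \<bullet> x)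
          - (1 - c) * (?a * (norm x)\<^sup>2 + blinfun_apply A x \<bullet> x)"
        by (subst c_eq) (simp add: algebra_simps)
      also have "\<dots> \<le> c * (\<mu> * (norm x)\<^sup>2 - blinfun_apply A x \<bullet> x)"
        using a[of x] c by simp
      finally show ?thesis .
    qed
    then show ?thesis using norm_compressed_resolvent_le_iff[OF \<mu> c(1)] c(2) by fastforce
  qed
  moreover have "norm (A + P) < \<mu>" if "?N < 1"
  proof -
    \<comment> \<open>The norm may be 0, while the form criterion requires a positive
      constant.\<close>
    define c where "c = max ?N (1 / 2)"
    have c: "0 < c" "c < 1" "?N \<le> c" using that by (auto simp: c_def)
    \<comment> \<open>The criterion gives \<open>A + P\<close> \<le> \<open>c\<close> \<mu> + (1 -
      \<open>c\<close>) \<open>A\<close> as forms, and \<nu> is the bound resulting from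
      \<open>A\<close> \<le> \<open>norm A\<close>. As a convex combination it lies strictly between
      \<open>norm A\<close> and \<mu>.\<close>
    define \<nu> where "\<nu> = c * \<mu> + (1 - c) * ?a"
    have \<nu>_a: "\<nu> - ?a = c * (\<mu> - ?a)" and \<nu>_\<mu>: "\<mu> - \<nu> = (1 - c) * (\<mu> - ?a)"
      by (simp_all add: \<nu>_def algebra_simps)
    have "0 < \<nu> - ?a" unfolding \<nu>_a using c \<mu> by simp
    moreover have "0 < \<mu> - \<nu>" unfolding \<nu>_\<mu> using c \<mu> by simp
    ultimately have \<nu>: "?a \<le> \<nu>" "\<nu> < \<mu>" by simp_all
    have "blinfun_apply A x \<bullet> x + (norm (blinfun_apply P x))\<^sup>2 \<le> \<nu> * (norm x)\<^sup>2" for x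
    proof -
      have "(norm (blinfun_apply P x))\<^sup>2 \<le> c * (\<mu> * (norm x)\<^sup>2 - blinfun_apply A x \<bullet> x)"
        using norm_compressed_resolvent_le_iff[OF \<mu> c(1)] c(3) by blast
      then have "blinfun_apply A x \<bullet> x + (norm (blinfun_apply P x))\<^sup>2
          \<le> c * \<mu> * (norm x)\<^sup>2 + (1 - c) * (blinfun_apply A x \<bullet> x)"
        by (simp add: algebra_simps)
      also have "\<dots> \<le> c * \<mu> * (norm x)\<^sup>2 + (1 - c) * (?a * (norm x)\<^sup>2)"
        using a[of x] c by (intro add_left_mono mult_left_mono) auto
      finally show ?thesis by (simp add: \<nu>_def algebra_simps)
    qed
    then show ?thesis using norm_sum_le_iff[OF \<nu>(1)] \<nu>(2) by fastforce
  qed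
  ultimately show ?thesis using le by linarith
qed

end

section \<open>Adjacency operators of graphs of bounded degree\<close>

lemma symmetric_projection_ell2_on: "symmetric_op (orthogonal_projection (ell2_on S))"
  unfolding symmetric_op_def inner_ell2_def
  by (auto simp: orthogonal_projection_ell2_on_apply intro!: infsum_cong)

lemma projection_ell2_on_idem:
  "blinfun_apply (orthogonal_projection (ell2_on S))
     (blinfun_apply (orthogonal_projection (ell2_on S)) f)
   = blinfun_apply (orthogonal_projection (ell2_on S)) f"
  by (rule ell2_eqI) (simp add: orthogonal_projection_ell2_on_apply)

section \<open>Rows of the adjacency matrix\<close>

lemma adj_entry_commute: "adj_entry G x y = adj_entry G y x"
  by (simp add: adj_entry_def insert_commute)

text \<open>The edges from \<open>x\<close> to different vertices form disjoint sets of edges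
  incident with \<open>x\<close>; a loop is counted once on both sides.\<close>

lemma sum_adj_entry_le_degree:
  assumes fin: "finite (incident G x)" and "finite F"
  shows "(\<Sum>y\<in>F. adj_entry G x y) \<le> card (incident G x)"
proof -
  have fine: "finite {e \<in> edges G. ends G e = {x, y}}" for y
    by (rule finite_subset[OF _ fin]) (auto simp: incident_def)
  have "(\<Sum>y\<in>F. adj_entry G x y) = card (\<Union>y\<in>F. {e \<in> edges G. ends G e = {x, y}})"
    unfolding adj_entry_def
    by (rule card_UN_disjoint[symmetric]) (use assms fine in \<open>auto simp: doubleton_eq_iff\<close>)
  also have "\<dots> \<le> card (incident G x)"
    by (rule card_mono[OF fin]) (auto simp: incident_def)
  finally show ?thesis .
qed

text \<open>Each neighbour adds at least 1 to the row sum, so there cannot be more neighbours than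
  incident edges.\<close>

lemma finite_neighbours:
  assumes fin: "finite (incident G x)"
  shows "finite {y. adj_entry G x y \<noteq> 0}"
proof (rule ccontr)
  assume "infinite {y. adj_entry G x y \<noteq> 0}"
  then obtain F where F: "F \<subseteq> {y. adj_entry G x y \<noteq> 0}" "finite F"
      "card F = Suc (card (incident G x))"
    using infinite_arbitrarily_large by blast
  have "(\<Sum>y\<in>F. 1) \<le> (\<Sum>y\<in>F. adj_entry G x y)"
    using F(1) by (intro sum_mono) (auto simp: Suc_le_eq)
  with sum_adj_entry_le_degree[OF fin F(2)] F(3) show False by simp
qed

lemma summable_adj_entry_row:
  fixes h :: "'v \<Rightarrow> complex"
  assumes "finite (incident G x)"
  shows "(\<lambda>y. of_nat (adj_entry G x y) * h y) summable_on UNIV"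
proof -
  have "(\<lambda>y. of_nat (adj_entry G x y) * h y) summable_on {y. adj_entry G x y \<noteq> 0}"
    by (rule summable_on_finite[OF finite_neighbours[OF assms]])
  then show ?thesis by (rule summable_on_cong_neutral[THEN iffD1, rotated -1]) auto
qed

section \<open>Symmetry of the adjacency operator and the effect of loops\<close>

locale bounded_degree_graph =
  fixes G :: "('v, 'e) ugraph" and d :: nat
  assumes wf: "wf_ugraph G"
    and fin: "finite (incident G x)" and deg: "card (incident G x) \<le> d"
begin

text \<open>Enclosing a finite set of pairs in a rectangle makes the inner sums row sums, each at
  most \<open>d\<close>. The result majorizes the double series in the symmetry proof.\<close>

lemma summable_adj_entry_square:
  "(\<lambda>(x, y). real (adj_entry G x y) * (cmod (ell2_apply g x))\<^sup>2) summable_on UNIV"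
proof (rule nonneg_bdd_above_summable_on)
  show "bdd_above (sum (\<lambda>(x, y). real (adj_entry G x y) * (cmod (ell2_apply g x))\<^sup>2) `
      {F. F \<subseteq> UNIV \<and> finite F})"
  proof (rule bdd_aboveI2)
    fix F :: "('v \<times> 'v) set"
    assume "F \<in> {F. F \<subseteq> UNIV \<and> finite F}"
    then have "finite F" by simp
    then have fins: "finite (fst ` F)" "finite (snd ` F)" by auto
    have "(\<Sum>(x, y)\<in>F. real (adj_entry G x y) * (cmod (ell2_apply g x))\<^sup>2)
        \<le> (\<Sum>(x, y)\<in>fst ` F \<times> snd ` F. real (adj_entry G x y) * (cmod (ell2_apply g x))\<^sup>2)"
      using fins by (intro sum_mono2) (auto simp: image_iff, force+)
    also have "\<dots> = (\<Sum>x\<in>fst ` F. real (\<Sum>y\<in>snd ` F. adj_entry G x y) * (cmod (ell2_apply g x))\<^sup>2)"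
      by (simp add: sum.cartesian_product[symmetric] sum_distrib_right)
    also have "\<dots> \<le> (\<Sum>x\<in>fst ` F. real d * (cmod (ell2_apply g x))\<^sup>2)"
      using order_trans[OF sum_adj_entry_le_degree[OF fin fins(2)] deg]
      by (intro sum_mono mult_right_mono of_nat_mono) auto
    also have "\<dots> \<le> real d * (norm g)\<^sup>2"
      unfolding sum_distrib_left[symmetric]
      by (intro mult_left_mono norm_ell2_sum_le fins) auto
    finally show "(\<Sum>(x, y)\<in>F. real (adj_entry G x y) * (cmod (ell2_apply g x))\<^sup>2)
        \<le> real d * (norm g)\<^sup>2" .
  qed
qed auto

text \<open>Both sides are iterated sums of the same double series \<open>k\<close>, by symmetry of
  the entries. Absolute summability, from uv \<le> u^2 + v^2, permits exchanging the order.\<close>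

lemma symmetric_adjacency_operator: "symmetric_op (adjacency_operator G)"
  unfolding symmetric_op_def
proof (intro allI)
  fix f g :: "'v ell2"
  note app = adjacency_operator_apply[OF fin deg wf]
  define k where "k x y = real (adj_entry G x y) * (ell2_apply f y \<bullet> ell2_apply g x)" for x y
  have k: "(\<lambda>(x, y). k x y) summable_on UNIV"
  proof (rule abs_summable_summable, rule summable_on_comparison_test)
    \<comment> \<open>The summability lemma weights the first coordinate; swapping the pair and
      using symmetry of the entries moves the weight to the second.\<close>
    have "(\<lambda>(x, y). real (adj_entry G x y) * (cmod (ell2_apply f y))\<^sup>2) summable_on UNIV"
      using summable_adj_entry_square[of f]
      by (subst (asm) summable_on_reindex_bij_betw[OF bij_swap, symmetric])
        (simp add: adj_entry_commute split_def)
    then show "(\<lambda>p. (case p of (x, y) \<Rightarrow> real (adj_entry G x y) * (cmod (ell2_apply f y))\<^sup>2)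
        + (case p of (x, y) \<Rightarrow> real (adj_entry G x y) * (cmod (ell2_apply g x))\<^sup>2)) summable_on UNIV"
      using summable_adj_entry_square[of g] by (rule summable_on_add)
    fix p :: "'v \<times> 'v"
    obtain x y where p: "p = (x, y)" by fastforce
    let ?u = "cmod (ell2_apply f y)" and ?v = "cmod (ell2_apply g x)"
    have "\<bar>ell2_apply f y \<bullet> ell2_apply g x\<bar> \<le> ?u * ?v" by (rule Cauchy_Schwarz_ineq2)
    also have "\<dots> \<le> ?u\<^sup>2 + ?v\<^sup>2"
    proof -
      have "0 \<le> ?u * ?v" by simp
      with sum_squares_bound[of ?u ?v] show ?thesis by linarith
    qed
    finally show "norm (case p of (x, y) \<Rightarrow> k x y)
      \<le> (case p of (x, y) \<Rightarrow> real (adj_entry G x y) * (cmod (ell2_apply f y))\<^sup>2)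
        + (case p of (x, y) \<Rightarrow> real (adj_entry G x y) * (cmod (ell2_apply g x))\<^sup>2)"
      by (simp add: p k_def abs_mult distrib_left[symmetric] mult_left_mono)
  qed auto
  have row: "(\<Sum>\<^sub>\<infinity>y. of_nat (adj_entry G x y) * ell2_apply h y) \<bullet> z
      = (\<Sum>\<^sub>\<infinity>y. real (adj_entry G x y) * (ell2_apply h y \<bullet> z))" for h :: "'v ell2" and x z
  proof -
    have "(\<Sum>\<^sub>\<infinity>y. of_nat (adj_entry G x y) * ell2_apply h y) \<bullet> z
        = (\<Sum>\<^sub>\<infinity>y. (of_nat (adj_entry G x y) * ell2_apply h y) \<bullet> z)"
      by (intro infsumI[symmetric] has_sum_bounded_linear[OF bounded_linear_inner_left]
          has_sum_infsum summable_adj_entry_row fin)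
    also have "\<dots> = (\<Sum>\<^sub>\<infinity>y. real (adj_entry G x y) * (ell2_apply h y \<bullet> z))"
      by (intro infsum_cong) (simp add: inner_complex_def algebra_simps)
    finally show ?thesis .
  qed
  have "blinfun_apply (adjacency_operator G) f \<bullet> g = (\<Sum>\<^sub>\<infinity>x. \<Sum>\<^sub>\<infinity>y. k x y)"
    by (simp add: inner_ell2_def app row k_def)
  also have "\<dots> = (\<Sum>\<^sub>\<infinity>y. \<Sum>\<^sub>\<infinity>x. k x y)"
    using k by (intro infsum_swap_banach) simp
  also have "\<dots> = blinfun_apply (adjacency_operator G) g \<bullet> f"
  proof -
    have "k x y = real (adj_entry G y x) * (ell2_apply g x \<bullet> ell2_apply f y)" for x y
      by (simp add: k_def adj_entry_commute[of G x] inner_commute)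
    then show ?thesis by (simp add: inner_ell2_def app row)
  qed
  finally show "blinfun_apply (adjacency_operator G) f \<bullet> g
      = f \<bullet> blinfun_apply (adjacency_operator G) g"
    by (simp add: inner_commute)
qed

text \<open>Loops add 1 to the diagonal entries at \<open>S\<close>, which is the matrix of the
  projection. The new graph has degrees at most \<open>Suc d\<close>, so its operator is also given
  by its matrix.\<close>

lemma adjacency_operator_add_loops:
  "adjacency_operator (add_loops G S) = adjacency_operator G + orthogonal_projection (ell2_on S)"
proof (intro blinfun_eqI ell2_eqI)
  fix f :: "'v ell2" and x
  have inc: "incident (add_loops G S) x = Inl ` incident G x \<union> (if x \<in> S then {Inr x} else {})" for x
    by (auto simp: incident_def add_loops_def)
  have fin': "finite (incident (add_loops G S) x)" for x
    by (simp add: inc fin)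
  have deg': "card (incident (add_loops G S) x) \<le> Suc d" for x
    using deg[of x] fin[of x] by (auto simp: inc card_image card_insert_if)
  have wf': "wf_ugraph (add_loops G S)"
    using wf by (auto simp: wf_ugraph_def add_loops_def)
  \<comment> \<open>\<open>l\<close> is the contribution of the loops to row \<open>x\<close>; it is
    nonzero at most at \<open>x\<close>, so it splits off the row sum.\<close>
  define l where "l y = (if x = y \<and> x \<in> S then ell2_apply f y else 0)" for y
  have l: "(l has_sum (if x \<in> S then ell2_apply f x else 0)) UNIV"
    by (rule has_sum_finite_neutralI[of "{x}"]) (auto simp: l_def)
  have "ell2_apply (blinfun_apply (adjacency_operator (add_loops G S)) f) x
      = (\<Sum>\<^sub>\<infinity>y. of_nat (adj_entry G x y) * ell2_apply f y + l y)"
    unfolding adjacency_operator_apply[OF fin' deg' wf'] adj_entry_add_loops[OF fin]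
    by (intro infsum_cong) (auto simp: l_def algebra_simps)
  also have "\<dots> = (\<Sum>\<^sub>\<infinity>y. of_nat (adj_entry G x y) * ell2_apply f y)
      + (if x \<in> S then ell2_apply f x else 0)"
    using infsum_add[OF summable_adj_entry_row[OF fin] has_sum_imp_summable[OF l]] infsumI[OF l]
    by simp
  finally show "ell2_apply (blinfun_apply (adjacency_operator (add_loops G S)) f) x
      = ell2_apply (blinfun_apply
          (adjacency_operator G + orthogonal_projection (ell2_on S)) f) x"
    by (simp add: blinfun.add_left plus_ell2.rep_eq adjacency_operator_apply[OF fin deg wf]
        orthogonal_projection_ell2_on_apply)
qed

end

section \<open>Application to the Cayley tree\<close>

theorem theorem3p2:
  fixes Q :: nat and G :: "('v, 'e) ugraph" and S :: "'v set"
  assumes "Q \<ge> 2" and "is_Cayley_tree Q G"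
  shows "let A = adjacency_operator G;
             Y = add_loops G S;
             P = orthogonal_projection (ell2_on S);
             is_sol = (\<lambda>\<mu>. \<mu> > norm A \<and> norm (P o\<^sub>L resolvent A \<mu> o\<^sub>L P) = 1)
         in (\<exists>\<^sub>\<le>\<^sub>1 \<mu>. is_sol \<mu>) \<and>
            (\<forall>\<mu>. is_sol \<mu> \<longrightarrow> \<mu> = norm (adjacency_operator Y)) \<and>
            (norm (adjacency_operator Y) > norm A \<longrightarrow> is_sol (norm (adjacency_operator Y)))"
proof -
  interpret bounded_degree_graph G Q
    using assms(2) by unfold_locales (auto simp: is_Cayley_tree_def is_tree_def)
  interpret projection_perturbation "adjacency_operator G" "orthogonal_projection (ell2_on S)"
    by unfold_locales
      (rule symmetric_adjacency_operator symmetric_projection_ell2_on projection_ell2_on_idem)+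
  \<comment> \<open>Above \<open>norm A\<close>, being a solution means being equal to the norm of
    \<open>A + P\<close>, a fixed number; uniqueness, its value and the converse all follow.\<close>
  show ?thesis
    unfolding Let_def adjacency_operator_add_loops
    using norm_compressed_resolvent_eq_1_iff by (auto simp: Uniq_def)
qed

end
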